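(* Let $(S,\lhd,\widetilde\lhd)$ be a quandle with a fixed element $a\in S$, and let $\Bbbk$ be a field. A pre-bisimplicial structure on $T(\Bbbk S)$ is given by the linear extensions of $$d_{n;i}(a_1,\ldots,a_n)=\delta_{a,a_i}\,(a_1\lhd a_i,\ldots,a_{i-1}\lhd a_i,a_{i+1},\ldots,a_n),$$ $$d'_{n;i}(a_1,\ldots,a_n)=\delta_{a,(\cdots(a_i\lhd a_{i+1})\lhd\cdots)\lhd a_n}\,(a_1,\ldots,\widehat{a_i},\ldots,a_n).$$ Moreover, the face maps $d_{n;i}$ combined with the degeneracies $s_{n;i}(a_1,\ldots,a_n)=(a_1,\ldots,a_{i-1},a_i,a_i,a_{i+1},\ldots,a_n)$ give a weakly simplicial structure.
   Context: A quandle is a set $S$ with binary operations $\lhd,\widetilde\lhd$ such that for all $a,b,c$: $(a\lhd b)\lhd c=(a\lhd c)\lhd(b\lhd c)$, $(a\lhd b)\widetilde\lhd b=(a\widetilde\lhd b)\lhd b=a$, and $a\lhd a=a$. $\delta_{x,y}$ is the Kronecker delta. $\Bbbk S$ is the vector space with basis $S$; $T(\Bbbk S)=\bigoplus_{n\ge0}(\Bbbk S)^{\otimes n}$, where $(\Bbbk S)^{\otimes n}$ has basis $S^{\times n}$, its elements written $(a_1,\ldots,a_n)$. Simplicial vocabulary, for vector spaces $V_n$ ($n\ge0$; here $V_n=(\Bbbk S)^{\otimes n}$) with linear maps $d_{n;i},d'_{n;i}:V_n\to V_{n-1}$, $s_{n;i}:V_n\to V_{n+1}$, $1\le i\le n$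 (first subscripts omitted, composites having source $V_n$): pre-bisimplicial: for $1\le i<j\le n$, $d_id_j=d_{j-1}d_i$, $d'_id'_j=d'_{j-1}d'_i$, $d_id'_j=d'_{j-1}d_i$, $d'_id_j=d_{j-1}d'_i$; weakly simplicial (for $d,s$): $d_id_j=d_{j-1}d_i$ for $1\le i<j\le n$, $s_is_j=s_{j+1}s_i$ for $1\le i\le j\le n$, $d_is_j=s_{j-1}d_i$ for $1\le i<j\le n$, $d_is_j=s_jd_{i-1}$ for $1\le j$, $j+1<i\le n+1$, and $d_is_i=d_{i+1}s_i$ for $1\le i\le n$. *)

theory Defs
  imports Complex_Main "HOL-Library.Poly_Mapping" "HOL-Library.FuncSet"
begin

locale quandle =
  fixes S :: "'a set"
    and op :: "'a \<Rightarrow> 'a \<Rightarrow> 'a"  (infixl \<open>\<lhd>\<close> 70)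
    and op' :: "'a \<Rightarrow> 'a \<Rightarrow> 'a"  (infixl \<open>\<lhd>''\<close> 70)
  assumes op_closed: "\<lbrakk>x \<in> S; y \<in> S\<rbrakk> \<Longrightarrow> x \<lhd> y \<in> S"
    and op'_closed: "\<lbrakk>x \<in> S; y \<in> S\<rbrakk> \<Longrightarrow> x \<lhd>' y \<in> S"
    and self_distrib: "\<lbrakk>x \<in> S; y \<in> S; z \<in> S\<rbrakk> \<Longrightarrow> (x \<lhd> y) \<lhd> z = (x \<lhd> z) \<lhd> (y \<lhd> z)"
    and op_op': "\<lbrakk>x \<in> S; y \<in> S\<rbrakk> \<Longrightarrow> (x \<lhd> y) \<lhd>' y = x"
    and op'_op: "\<lbrakk>x \<in> S; y \<in> S\<rbrakk> \<Longrightarrow> (x \<lhd>' y) \<lhd> y = x"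
    and idem: "x \<in> S \<Longrightarrow> x \<lhd> x = x"

definition linear_map_on ::
  "('k \<Rightarrow> 'v \<Rightarrow> 'v) \<Rightarrow> 'v set \<Rightarrow> 'v set \<Rightarrow> ('v::ab_group_add \<Rightarrow> 'v) \<Rightarrow> bool" where
  "linear_map_on scale U W f \<longleftrightarrow>
     f \<in> U \<rightarrow> W \<and>
     (\<forall>x\<in>U. \<forall>y\<in>U. f (x + y) = f x + f y) \<and>
     (\<forall>c. \<forall>x\<in>U. f (scale c x) = scale c (f x))"

text \<open>A sequence of vector spaces is given as a sequence of subspaces of one ambient space
  (for instance, of its direct sum). In \<open>d n i\<close> the first argument is the degree of the source;
  only the values on \<open>V n\<close> with \<open>1 \<le> i \<le> n\<close> matter.\<close>

locale vector_space_sequence = vector_space scale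
  for scale :: "'k::field \<Rightarrow> 'v::ab_group_add \<Rightarrow> 'v" +
  fixes V :: "nat \<Rightarrow> 'v set"
  assumes subspace_V: "subspace (V n)"

locale pre_bisimplicial = vector_space_sequence scale V
  for scale :: "'k::field \<Rightarrow> 'v::ab_group_add \<Rightarrow> 'v" and V +
  fixes d d' :: "nat \<Rightarrow> nat \<Rightarrow> 'v \<Rightarrow> 'v"
  assumes d_linear: "\<lbrakk>1 \<le> i; i \<le> n\<rbrakk> \<Longrightarrow> linear_map_on scale (V n) (V (n - 1)) (d n i)"
    and d'_linear: "\<lbrakk>1 \<le> i; i \<le> n\<rbrakk> \<Longrightarrow> linear_map_on scale (V n) (V (n - 1)) (d' n i)"
    and d_d: "\<lbrakk>1 \<le> i; i < j; j \<le> n; v \<in> V n\<rbrakk>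
      \<Longrightarrow> d (n - 1) i (d n j v) = d (n - 1) (j - 1) (d n i v)"
    and d'_d': "\<lbrakk>1 \<le> i; i < j; j \<le> n; v \<in> V n\<rbrakk>
      \<Longrightarrow> d' (n - 1) i (d' n j v) = d' (n - 1) (j - 1) (d' n i v)"
    and d_d': "\<lbrakk>1 \<le> i; i < j; j \<le> n; v \<in> V n\<rbrakk>
      \<Longrightarrow> d (n - 1) i (d' n j v) = d' (n - 1) (j - 1) (d n i v)"
    and d'_d: "\<lbrakk>1 \<le> i; i < j; j \<le> n; v \<in> V n\<rbrakk>
      \<Longrightarrow> d' (n - 1) i (d n j v) = d (n - 1) (j - 1) (d' n i v)"

locale weakly_simplicial = vector_space_sequence scale V
  for scale :: "'k::field \<Rightarrow> 'v::ab_group_add \<Rightarrow> 'v" and V +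
  fixes d s :: "nat \<Rightarrow> nat \<Rightarrow> 'v \<Rightarrow> 'v"
  assumes d_linear: "\<lbrakk>1 \<le> i; i \<le> n\<rbrakk> \<Longrightarrow> linear_map_on scale (V n) (V (n - 1)) (d n i)"
    and s_linear: "\<lbrakk>1 \<le> i; i \<le> n\<rbrakk> \<Longrightarrow> linear_map_on scale (V n) (V (n + 1)) (s n i)"
    and d_d: "\<lbrakk>1 \<le> i; i < j; j \<le> n; v \<in> V n\<rbrakk>
      \<Longrightarrow> d (n - 1) i (d n j v) = d (n - 1) (j - 1) (d n i v)"
    and s_s: "\<lbrakk>1 \<le> i; i \<le> j; j \<le> n; v \<in> V n\<rbrakk>
      \<Longrightarrow> s (n + 1) i (s n j v) = s (n + 1) (j + 1) (s n i v)"
    and d_s_less: "\<lbrakk>1 \<le> i; i < j; j \<le> n; v \<in> V n\<rbrakk>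
      \<Longrightarrow> d (n + 1) i (s n j v) = s (n - 1) (j - 1) (d n i v)"
    and d_s_greater: "\<lbrakk>1 \<le> j; j + 1 < i; i \<le> n + 1; v \<in> V n\<rbrakk>
      \<Longrightarrow> d (n + 1) i (s n j v) = s (n - 1) j (d n (i - 1) v)"
    and d_s_eq: "\<lbrakk>1 \<le> i; i \<le> n; v \<in> V n\<rbrakk>
      \<Longrightarrow> d (n + 1) i (s n i v) = d (n + 1) (i + 1) (s n i v)"

text \<open>Elements of the tensor space \<open>T(kS)\<close> are finitely supported functions on words over \<open>S\<close>;
  the \<open>n\<close>-th tensor power consists of those supported on words of length \<open>n\<close>, and the word
  \<open>w\<close> is identified with the basis vector \<open>Poly_Mapping.single w 1\<close>.\<close>

definition tensor_power :: "'a set \<Rightarrow> nat \<Rightarrow> ('a list \<Rightarrow>\<^sub>0 'k::field) set" where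
  "tensor_power S n = {v. Poly_Mapping.keys v \<subseteq> {w \<in> lists S. length w = n}}"

definition scale_pm :: "'k::field \<Rightarrow> ('b \<Rightarrow>\<^sub>0 'k) \<Rightarrow> ('b \<Rightarrow>\<^sub>0 'k)" where
  "scale_pm c v = Poly_Mapping.map ((*) c) v"

definition linear_extension ::
  "('b \<Rightarrow> ('c \<Rightarrow>\<^sub>0 'k)) \<Rightarrow> ('b \<Rightarrow>\<^sub>0 'k) \<Rightarrow> ('c \<Rightarrow>\<^sub>0 'k::field)" where
  "linear_extension f v =
     (\<Sum>w\<in>Poly_Mapping.keys v. scale_pm (Poly_Mapping.lookup v w) (f w))"

text \<open>Positions \<open>i\<close> below are counted from 1 while list indices start at 0, so the \<open>i\<close>-th letter
  of \<open>w\<close> is \<open>w ! (i - 1)\<close>. The Kronecker delta is \<open>of_bool (x = y)\<close>. The maps are indexed by the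
  degree \<open>n\<close> of the source to match the simplicial vocabulary, although the formulas do not
  depend on it.\<close>

definition face ::
  "('a \<Rightarrow> 'a \<Rightarrow> 'a) \<Rightarrow> 'a \<Rightarrow> nat \<Rightarrow> nat \<Rightarrow> ('a list \<Rightarrow>\<^sub>0 'k) \<Rightarrow> ('a list \<Rightarrow>\<^sub>0 'k::field)" where
  "face op a n i = linear_extension (\<lambda>w.
     scale_pm (of_bool (a = w ! (i - 1)))
       (Poly_Mapping.single (map (\<lambda>x. op x (w ! (i - 1))) (take (i - 1) w) @ drop i w) 1))"

definition face' ::
  "('a \<Rightarrow> 'a \<Rightarrow> 'a) \<Rightarrow> 'a \<Rightarrow> nat \<Rightarrow> nat \<Rightarrow> ('a list \<Rightarrow>\<^sub>0 'k) \<Rightarrow> ('a list \<Rightarrow>\<^sub>0 'k::field)" where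
  "face' op a n i = linear_extension (\<lambda>w.
     scale_pm (of_bool (a = foldl op (w ! (i - 1)) (drop i w)))
       (Poly_Mapping.single (take (i - 1) w @ drop i w) 1))"

definition degeneracy ::
  "nat \<Rightarrow> nat \<Rightarrow> ('a list \<Rightarrow>\<^sub>0 'k) \<Rightarrow> ('a list \<Rightarrow>\<^sub>0 'k::field)" where
  "degeneracy n i = linear_extension (\<lambda>w.
     Poly_Mapping.single (take (i - 1) w @ [w ! (i - 1), w ! (i - 1)] @ drop i w) 1)"

end

theory Submission imports Defs begin

text \<open>
  All maps involved send a basis word either to a basis word or to \<open>0\<close>. Such a map is the linear
  extension of a partial function on words, and composing linear extensions amounts to composing
  the partial functions (\<open>extend_compose\<close>). Every simplicial identity thereby reduces to an equality
  of two partial functions on words, that is, to two claims: the resulting words agree, and the two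
  Kronecker conditions on the left are jointly equivalent to those on the right.

  Write \<open>R\<^sub>y x = x \<lhd> y\<close>. In a quandle, each \<open>R\<^sub>y\<close> is an injective endomorphism fixing \<open>y\<close>. The
  resulting words agree because a face \<open>d\<^sub>i\<close> that does not vanish acts by \<open>R\<^sub>a\<close>, the same map in
  every place. For the conditions, there are three points beyond bookkeeping:
  \<^item> in \<open>d\<^sub>i d\<^sub>j\<close>, the letter \<open>x\<close> in place \<open>i\<close> is tested after \<open>R\<^sub>a\<close> was applied, and \<open>x \<lhd> a = a\<close> iff
    \<open>x = a\<close> (\<open>act_eq_actor_iff\<close>);
  \<^item> in \<open>d'\<^sub>i d'\<^sub>j\<close>, deleting the letter \<open>y\<close> in place \<open>j\<close> changes the product tested for place \<open>i\<close> from
    \<open>p \<lhd> q\<close> to \<open>p\<close>, where \<open>q\<close> is the product tested for place \<open>j\<close> (\<open>foldl_act\<close>); as \<open>q = a\<close>,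
    the same equivalence applies;
  \<^item> in \<open>d'\<^sub>i d\<^sub>j\<close>, applying \<open>R\<^sub>y\<close> to all letters before \<open>y\<close> and deleting \<open>y\<close> does not change the
    products from the left, as \<open>R\<^sub>y\<close> is an endomorphism (\<open>foldl_map_act\<close>).

  Finally \<open>d\<^sub>i s\<^sub>i = d\<^sub>i\<^sub>+\<^sub>1 s\<^sub>i\<close> needs \<open>x \<lhd> x = x\<close> for the doubled letter.
\<close>

section \<open>Linear extensions of maps on a basis\<close>

lemma lookup_scale_pm [simp]: "Poly_Mapping.lookup (scale_pm c v) w = c * Poly_Mapping.lookup v w"
  unfolding scale_pm_def by (simp add: Poly_Mapping.map.rep_eq when_def)

interpretation pm: vector_space "scale_pm :: 'k::field \<Rightarrow> ('b \<Rightarrow>\<^sub>0 'k) \<Rightarrow> ('b \<Rightarrow>\<^sub>0 'k)"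
  by unfold_locales (auto intro!: poly_mapping_eqI simp: lookup_add algebra_simps)

text \<open>The sum defining a linear extension runs over the support of its argument; additivity needs
  one index set that serves several arguments.\<close>

lemma linear_extension_superset:
  assumes "finite A" "Poly_Mapping.keys v \<subseteq> A"
  shows "linear_extension f v = (\<Sum>w\<in>A. scale_pm (Poly_Mapping.lookup v w) (f w))"
  unfolding linear_extension_def
  by (rule sum.mono_neutral_left) (use assms in \<open>auto simp: in_keys_iff\<close>)

lemma linear_extension_add:
  "linear_extension f (u + v) = linear_extension f u + linear_extension f v"
proof -
  let ?A = "Poly_Mapping.keys u \<union> Poly_Mapping.keys v"
  have "Poly_Mapping.keys (u + v) \<subseteq> ?A" by (rule Poly_Mapping.keys_add)
  then show ?thesis
    by (simp add: linear_extension_superset[of ?A] lookup_add pm.scale_left_distrib sum.distrib)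
qed

lemma linear_extension_scale:
  "linear_extension f (scale_pm c v) = scale_pm c (linear_extension f v)"
proof -
  have "Poly_Mapping.keys (scale_pm c v) \<subseteq> Poly_Mapping.keys v"
    by (auto simp: in_keys_iff)
  then show ?thesis
    by (simp add: linear_extension_superset[of "Poly_Mapping.keys v"] pm.scale_sum_right)
qed

lemma linear_extension_zero [simp]: "linear_extension f 0 = 0"
  by (simp add: linear_extension_def)

lemma linear_extension_single [simp]: "linear_extension f (Poly_Mapping.single w 1) = f w"
  by (simp add: linear_extension_def)

lemma linear_extension_sum:
  "linear_extension f (\<Sum>x\<in>A. g x) = (\<Sum>x\<in>A. linear_extension f (g x))"
  by (induction A rule: infinite_finite_induct) (simp_all add: linear_extension_add)

lemma linear_extension_compose:
  "linear_extension g (linear_extension f v) = linear_extension (\<lambda>w. linear_extension g (f w)) v"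
  by (simp add: linear_extension_def[of f] linear_extension_def[of "\<lambda>w. linear_extension g (f w)"]
      linear_extension_sum linear_extension_scale)

lemma linear_extension_cong:
  assumes "\<And>w. w \<in> Poly_Mapping.keys v \<Longrightarrow> f w = g w"
  shows "linear_extension f v = linear_extension g v"
  unfolding linear_extension_def using assms by (intro sum.cong) auto

section \<open>Linear extensions of partial functions on words\<close>

definition basis_vector :: "'b option \<Rightarrow> ('b \<Rightarrow>\<^sub>0 'k::field)" where
  "basis_vector r = (case r of None \<Rightarrow> 0 | Some w \<Rightarrow> Poly_Mapping.single w 1)"

definition extend :: "('b \<Rightarrow> 'c option) \<Rightarrow> ('b \<Rightarrow>\<^sub>0 'k) \<Rightarrow> ('c \<Rightarrow>\<^sub>0 'k::field)" where
  "extend f = linear_extension (\<lambda>w. basis_vector (f w))"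

lemma extend_compose:
  fixes v :: "'b \<Rightarrow>\<^sub>0 'k::field"
  shows "extend g (extend f v) = extend (\<lambda>w. Option.bind (f w) g) v"
proof -
  have "linear_extension (\<lambda>w. basis_vector (g w) :: _ \<Rightarrow>\<^sub>0 'k) (basis_vector r)
      = basis_vector (Option.bind r g)" for r
    by (cases r) (simp_all add: basis_vector_def)
  then show ?thesis by (simp add: extend_def linear_extension_compose)
qed

lemma extend_compose_eqI:
  assumes "v \<in> tensor_power S n"
    and "\<And>w. w \<in> lists S \<Longrightarrow> length w = n \<Longrightarrow> Option.bind (f w) g = Option.bind (f' w) g'"
  shows "extend g (extend f v) = extend g' (extend f' v)"
  unfolding extend_compose unfolding extend_def
  by (rule linear_extension_cong) (use assms in \<open>force simp: tensor_power_def\<close>)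

lemma subspace_tensor_power:
  "pm.subspace (tensor_power S n :: ('a list \<Rightarrow>\<^sub>0 'k::field) set)"
proof -
  have "Poly_Mapping.keys (scale_pm c v) \<subseteq> Poly_Mapping.keys v" for c and v :: "'a list \<Rightarrow>\<^sub>0 'k"
    by (auto simp: in_keys_iff)
  then show ?thesis
    unfolding pm.subspace_def tensor_power_def
    using Poly_Mapping.keys_add by fastforce
qed

lemma extend_linear_map_on:
  assumes "\<And>w u. w \<in> lists S \<Longrightarrow> length w = n \<Longrightarrow> f w = Some u \<Longrightarrow> u \<in> lists S \<and> length u = m"
  shows "linear_map_on scale_pm (tensor_power S n) (tensor_power S m)
           (extend f :: ('a list \<Rightarrow>\<^sub>0 'k::field) \<Rightarrow> _)"
proof -
  have "extend f v \<in> tensor_power S m" if "v \<in> tensor_power S n" for v :: "'a list \<Rightarrow>\<^sub>0 'k"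
    unfolding extend_def linear_extension_def
  proof (intro pm.subspace_sum pm.subspace_scale subspace_tensor_power)
    fix w assume "w \<in> Poly_Mapping.keys v"
    with that have "w \<in> lists S" "length w = n" by (auto simp: tensor_power_def)
    then have "f w = None \<or> (\<exists>u. f w = Some u \<and> u \<in> lists S \<and> length u = m)"
      using assms by (cases "f w") blast+
    then show "basis_vector (f w) \<in> tensor_power S m"
      by (auto simp: basis_vector_def tensor_power_def)
  qed
  then show ?thesis
    by (auto simp: linear_map_on_def extend_def linear_extension_add linear_extension_scale)
qed

section \<open>Faces and degeneracies of words\<close>

definition face_word :: "('a \<Rightarrow> 'a \<Rightarrow> 'a) \<Rightarrow> 'a \<Rightarrow> nat \<Rightarrow> 'a list \<Rightarrow> 'a list option" where
  "face_word op a i w =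
     (if a = w ! (i - 1) then Some (map (\<lambda>x. op x (w ! (i - 1))) (take (i - 1) w) @ drop i w)
      else None)"

definition face'_word :: "('a \<Rightarrow> 'a \<Rightarrow> 'a) \<Rightarrow> 'a \<Rightarrow> nat \<Rightarrow> 'a list \<Rightarrow> 'a list option" where
  "face'_word op a i w =
     (if a = foldl op (w ! (i - 1)) (drop i w) then Some (take (i - 1) w @ drop i w) else None)"

definition degeneracy_word :: "nat \<Rightarrow> 'a list \<Rightarrow> 'a list option" where
  "degeneracy_word i w = Some (take (i - 1) w @ [w ! (i - 1), w ! (i - 1)] @ drop i w)"

lemma face_eq_extend: "face op a n i = extend (face_word op a i)"
  unfolding face_def extend_def
  by (rule arg_cong[where f = linear_extension]) (auto simp: face_word_def basis_vector_def)

lemma face'_eq_extend: "face' op a n i = extend (face'_word op a i)"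
  unfolding face'_def extend_def
  by (rule arg_cong[where f = linear_extension]) (auto simp: face'_word_def basis_vector_def)

lemma degeneracy_eq_extend: "degeneracy n i = extend (degeneracy_word i)"
  unfolding degeneracy_def extend_def degeneracy_word_def basis_vector_def by simp

text \<open>Splitting a word at the letter concerned replaces all index arithmetic by list equations.\<close>

lemma face_word_at:
  "i = Suc (length u) \<Longrightarrow>
     face_word op a i (u @ x # v) = (if a = x then Some (map (\<lambda>y. op y x) u @ v) else None)"
  by (simp add: face_word_def)

lemma face'_word_at:
  "i = Suc (length u) \<Longrightarrow>
     face'_word op a i (u @ x # v) = (if a = foldl op x v then Some (u @ v) else None)"
  by (simp add: face'_word_def)

lemma degeneracy_word_at:
  "i = Suc (length u) \<Longrightarrow> degeneracy_word i (u @ x # v) = Some (u @ x # x # v)"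
  by (simp add: degeneracy_word_def)

lemma split_at_index:
  assumes "1 \<le> i" "i \<le> length w"
  obtains u x v where "w = u @ x # v" "i = Suc (length u)"
proof
  show "w = take (i - 1) w @ w ! (i - 1) # drop i w"
    using assms id_take_nth_drop[of "i - 1" w] by simp
  show "i = Suc (length (take (i - 1) w))" using assms by simp
qed

lemma split_at_two_indices:
  assumes "1 \<le> i" "i < j" "j \<le> length w"
  obtains u x v y z where "w = u @ x # v @ y # z"
    "i = Suc (length u)" "j = Suc (Suc (length u + length v))"
proof -
  obtain p y z where p: "w = p @ y # z" "j = Suc (length p)"
    using split_at_index[of j w] assms by (metis le_trans less_imp_le)
  obtain u x v where u: "p = u @ x # v" "i = Suc (length u)"
    using split_at_index[of i p] assms p by (metis less_Suc_eq_le)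
  show ?thesis
    by (rule that[of u x v y z]) (use p u in simp_all)
qed

text \<open>Concatenation normalises to the right, so the splitting equations must also be available for
  a prefix that is itself composed of blocks and letters. The prefixes listed here are those that
  arise when a word split at one or two places is changed at one of them.\<close>

lemmas word_at =
  face_word_at
  face_word_at[of _ "u @ v" for u v, simplified]
  face_word_at[of _ "u @ x # v" for u x v, simplified]
  face_word_at[of _ "u @ [x]" for u x, simplified]
  face_word_at[of _ "u @ x # y # v" for u x y v, simplified]
  face'_word_at
  face'_word_at[of _ "u @ v" for u v, simplified]
  face'_word_at[of _ "u @ x # v" for u x v, simplified]
  degeneracy_word_at
  degeneracy_word_at[of _ "u @ v" for u v, simplified]
  degeneracy_word_at[of _ "u @ [x]" for u x, simplified]
  degeneracy_word_at[of _ "u @ x # v" for u x v, simplified]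
  degeneracy_word_at[of _ "u @ x # y # v" for u x y v, simplified]

lemma degeneracy_word_degeneracy_word:
  assumes "1 \<le> i" "i \<le> j" "j \<le> length w"
  shows "Option.bind (degeneracy_word j w) (degeneracy_word i)
       = Option.bind (degeneracy_word i w) (degeneracy_word (j + 1))"
proof (cases "i = j")
  case True
  obtain u x v where "w = u @ x # v" "i = Suc (length u)"
    using split_at_index[of i w] assms by (metis le_trans)
  with True show ?thesis by (simp add: word_at)
next
  case False
  with assms have "i < j" by simp
  then obtain u x v y z where "w = u @ x # v @ y # z"
    "i = Suc (length u)" "j = Suc (Suc (length u + length v))"
    using split_at_two_indices[OF assms(1) _ assms(3)] by blast
  then show ?thesis by (simp add: word_at)
qed

lemma face'_word_closed:
  assumes "w \<in> lists S" "1 \<le> i" "i \<le> length w" "face'_word op a i w = Some u"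
  shows "u \<in> lists S \<and> length u = length w - 1"
proof -
  obtain p x q where "w = p @ x # q" "i = Suc (length p)"
    by (rule split_at_index[OF assms(2,3)])
  with assms show ?thesis by (auto simp: word_at split: if_splits)
qed

lemma degeneracy_word_closed:
  assumes "w \<in> lists S" "1 \<le> i" "i \<le> length w" "degeneracy_word i w = Some u"
  shows "u \<in> lists S \<and> length u = length w + 1"
proof -
  obtain p x q where "w = p @ x # q" "i = Suc (length p)"
    by (rule split_at_index[OF assms(2,3)])
  with assms show ?thesis by (auto simp: word_at)
qed

lemma face_word_face'_word:
  assumes "1 \<le> i" "i < j" "j \<le> length w"
  shows "Option.bind (face'_word op a j w) (face_word op a i)
       = Option.bind (face_word op a i w) (face'_word op a (j - 1))"
proof -
  obtain u x v y z where "w = u @ x # v @ y # z"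
    "i = Suc (length u)" "j = Suc (Suc (length u + length v))"
    by (rule split_at_two_indices[OF assms(1-3)])
  then show ?thesis by (simp add: word_at)
qed

lemma face_word_degeneracy_word_less:
  assumes "1 \<le> i" "i < j" "j \<le> length w"
  shows "Option.bind (degeneracy_word j w) (face_word op a i)
       = Option.bind (face_word op a i w) (degeneracy_word (j - 1))"
proof -
  obtain u x v y z where "w = u @ x # v @ y # z"
    "i = Suc (length u)" "j = Suc (Suc (length u + length v))"
    by (rule split_at_two_indices[OF assms(1-3)])
  then show ?thesis by (simp add: word_at)
qed

lemma face_word_degeneracy_word_greater:
  assumes "1 \<le> j" "j + 1 < i" "i \<le> length w + 1"
  shows "Option.bind (degeneracy_word j w) (face_word op a i)
       = Option.bind (face_word op a (i - 1) w) (degeneracy_word j)"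
proof -
  have "j < i - 1" "i - 1 \<le> length w" using assms by auto
  then obtain u x v y z where "w = u @ x # v @ y # z"
    "j = Suc (length u)" "i - 1 = Suc (Suc (length u + length v))"
    using split_at_two_indices[OF assms(1)] by blast
  moreover from this have "i = Suc (Suc (Suc (length u + length v)))" by simp
  ultimately show ?thesis by (simp add: word_at)
qed

section \<open>Simplicial identities on words over a quandle\<close>

context quandle
begin

lemma act_eq_actor_iff:
  assumes "x \<in> S" "y \<in> S"
  shows "x \<lhd> y = y \<longleftrightarrow> x = y"
  using assms by (metis op_op' idem)

lemma foldl_closed: "x \<in> S \<Longrightarrow> zs \<in> lists S \<Longrightarrow> foldl (\<lhd>) x zs \<in> S"
  by (induction zs arbitrary: x) (auto simp: op_closed)

text \<open>Acting by the letters of \<open>zs\<close> in turn is a composite of endomorphisms.\<close>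

lemma foldl_act:
  "x \<in> S \<Longrightarrow> y \<in> S \<Longrightarrow> zs \<in> lists S \<Longrightarrow>
     foldl (\<lhd>) (x \<lhd> y) zs = foldl (\<lhd>) x zs \<lhd> foldl (\<lhd>) y zs"
proof (induction zs arbitrary: x y)
  case (Cons z zs)
  then show ?case
    using Cons.IH[of "x \<lhd> z" "y \<lhd> z"] by (simp add: op_closed self_distrib[of x y z])
qed simp

lemma foldl_map_act:
  "x \<in> S \<Longrightarrow> y \<in> S \<Longrightarrow> zs \<in> lists S \<Longrightarrow>
     foldl (\<lhd>) (x \<lhd> y) (map (\<lambda>z. z \<lhd> y) zs) = foldl (\<lhd>) x zs \<lhd> y"
  by (induction zs arbitrary: x) (auto simp: op_closed self_distrib[symmetric])

lemma face_word_closed: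
  assumes "w \<in> lists S" "1 \<le> i" "i \<le> length w" "face_word (\<lhd>) a i w = Some u"
  shows "u \<in> lists S \<and> length u = length w - 1"
proof -
  obtain p x q where "w = p @ x # q" "i = Suc (length p)"
    by (rule split_at_index[OF assms(2,3)])
  with assms show ?thesis by (auto simp: word_at op_closed split: if_splits)
qed

lemma face_word_face_word:
  assumes "w \<in> lists S" "a \<in> S" "1 \<le> i" "i < j" "j \<le> length w"
  shows "Option.bind (face_word (\<lhd>) a j w) (face_word (\<lhd>) a i)
       = Option.bind (face_word (\<lhd>) a i w) (face_word (\<lhd>) a (j - 1))"
proof -
  obtain u x v y z where w: "w = u @ x # v @ y # z"
    "i = Suc (length u)" "j = Suc (Suc (length u + length v))"
    by (rule split_at_two_indices[OF assms(3-5)])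
  have "a = x \<lhd> a \<longleftrightarrow> a = x" using assms w act_eq_actor_iff[of x a] by auto
  then show ?thesis using assms(2) by (auto simp: w word_at o_def)
qed

lemma face'_word_face'_word:
  assumes "w \<in> lists S" "a \<in> S" "1 \<le> i" "i < j" "j \<le> length w"
  shows "Option.bind (face'_word (\<lhd>) a j w) (face'_word (\<lhd>) a i)
       = Option.bind (face'_word (\<lhd>) a i w) (face'_word (\<lhd>) a (j - 1))"
proof -
  obtain u x v y z where w: "w = u @ x # v @ y # z"
    "i = Suc (length u)" "j = Suc (Suc (length u + length v))"
    by (rule split_at_two_indices[OF assms(3-5)])
  define p where "p = foldl (\<lhd>) (foldl (\<lhd>) x v) z"
  define q where "q = foldl (\<lhd>) y z"
  have "p \<in> S" using assms w by (auto simp: p_def intro!: foldl_closed)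
  then have iff: "a = p \<lhd> a \<longleftrightarrow> a = p" using assms(2) act_eq_actor_iff[of p a] by auto
  have "foldl (\<lhd>) (foldl (\<lhd>) x v \<lhd> y) z = p \<lhd> q"
    unfolding p_def q_def using assms(1) by (intro foldl_act foldl_closed) (auto simp: w)
  then show ?thesis using iff by (auto simp: w word_at p_def[symmetric] q_def[symmetric])
qed

lemma face'_word_face_word:
  assumes "w \<in> lists S" "1 \<le> i" "i < j" "j \<le> length w"
  shows "Option.bind (face_word (\<lhd>) a j w) (face'_word (\<lhd>) a i)
       = Option.bind (face'_word (\<lhd>) a i w) (face_word (\<lhd>) a (j - 1))"
proof -
  obtain u x v y z where w: "w = u @ x # v @ y # z"
    "i = Suc (length u)" "j = Suc (Suc (length u + length v))"
    by (rule split_at_two_indices[OF assms(2-4)])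
  have "foldl (\<lhd>) (x \<lhd> y) (map (\<lambda>t. t \<lhd> y) v) = foldl (\<lhd>) x v \<lhd> y"
    using assms(1) by (intro foldl_map_act) (auto simp: w)
  then show ?thesis by (simp add: w word_at)
qed

lemma face_word_degeneracy_word_eq:
  assumes "w \<in> lists S" "1 \<le> i" "i \<le> length w"
  shows "Option.bind (degeneracy_word i w) (face_word (\<lhd>) a i)
       = Option.bind (degeneracy_word i w) (face_word (\<lhd>) a (i + 1))"
proof -
  obtain u x v where "w = u @ x # v" "i = Suc (length u)"
    by (rule split_at_index[OF assms(2,3)])
  with assms(1) show ?thesis by (simp add: word_at idem)
qed

end

theorem proposition4p16:
  fixes S :: "'a set" and op op' :: "'a \<Rightarrow> 'a \<Rightarrow> 'a" and a :: 'a
  assumes "quandle S op op'"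
    and "a \<in> S"
  shows "pre_bisimplicial scale_pm (tensor_power S :: nat \<Rightarrow> ('a list \<Rightarrow>\<^sub>0 'k::field) set)
           (face op a) (face' op a)
       \<and> weakly_simplicial scale_pm (tensor_power S :: nat \<Rightarrow> ('a list \<Rightarrow>\<^sub>0 'k::field) set)
           (face op a) degeneracy"
proof -
  interpret quandle S op op' by fact
  let ?V = "tensor_power S :: nat \<Rightarrow> ('a list \<Rightarrow>\<^sub>0 'k) set"
  have seq: "vector_space_sequence scale_pm ?V"
    by unfold_locales (rule subspace_tensor_power)
  note as_extend = face_eq_extend face'_eq_extend degeneracy_eq_extend
  have face_linear: "linear_map_on scale_pm (?V n) (?V (n - 1)) (face op a n i)"
    if "1 \<le> i" "i \<le> n" for n i
    unfolding as_extend
    by (rule extend_linear_map_on) (use that face_word_closed in blast)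
  have face_face: "face op a (n - 1) i (face op a n j v) = face op a (n - 1) (j - 1) (face op a n i v)"
    if "1 \<le> i" "i < j" "j \<le> n" "v \<in> ?V n" for n i j v
    unfolding as_extend
    by (rule extend_compose_eqI[OF that(4)], rule face_word_face_word) (use that assms(2) in auto)
  have "pre_bisimplicial scale_pm ?V (face op a) (face' op a)"
  proof (intro pre_bisimplicial.intro[OF seq] pre_bisimplicial_axioms.intro face_linear face_face)
    fix n i j and v :: "'a list \<Rightarrow>\<^sub>0 'k"
    show "linear_map_on scale_pm (?V n) (?V (n - 1)) (face' op a n i)" if "1 \<le> i" "i \<le> n"
      unfolding as_extend
      by (rule extend_linear_map_on) (use that face'_word_closed[of _ S i op a] in blast)
    assume ij: "1 \<le> i" "i < j" "j \<le> n" and v: "v \<in> ?V n"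
    show "face' op a (n - 1) i (face' op a n j v) = face' op a (n - 1) (j - 1) (face' op a n i v)"
      unfolding as_extend
      by (rule extend_compose_eqI[OF v], rule face'_word_face'_word) (use ij assms(2) in auto)
    show "face op a (n - 1) i (face' op a n j v) = face' op a (n - 1) (j - 1) (face op a n i v)"
      unfolding as_extend
      by (rule extend_compose_eqI[OF v], rule face_word_face'_word) (use ij in auto)
    show "face' op a (n - 1) i (face op a n j v) = face op a (n - 1) (j - 1) (face' op a n i v)"
      unfolding as_extend
      by (rule extend_compose_eqI[OF v], rule face'_word_face_word) (use ij in auto)
  qed
  moreover have "weakly_simplicial scale_pm ?V (face op a) degeneracy"
  proof (intro weakly_simplicial.intro[OF seq] weakly_simplicial_axioms.intro face_linear face_face)
    fix n i j and v :: "'a list \<Rightarrow>\<^sub>0 'k"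
    show "linear_map_on scale_pm (?V n) (?V (n + 1)) (degeneracy n i)" if "1 \<le> i" "i \<le> n"
      unfolding as_extend
      by (rule extend_linear_map_on) (use that degeneracy_word_closed[of _ S i] in blast)
    assume v: "v \<in> ?V n"
    show "degeneracy (n + 1) i (degeneracy n j v) = degeneracy (n + 1) (j + 1) (degeneracy n i v)"
      if "1 \<le> i" "i \<le> j" "j \<le> n"
      unfolding as_extend
      by (rule extend_compose_eqI[OF v], rule degeneracy_word_degeneracy_word) (use that in auto)
    show "face op a (n + 1) i (degeneracy n j v) = degeneracy (n - 1) (j - 1) (face op a n i v)"
      if "1 \<le> i" "i < j" "j \<le> n"
      unfolding as_extend
      by (rule extend_compose_eqI[OF v], rule face_word_degeneracy_word_less) (use that in auto)
    show "face op a (n + 1) i (degeneracy n j v) = degeneracy (n - 1) j (face op a n (i - 1) v)"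
      if "1 \<le> j" "j + 1 < i" "i \<le> n + 1"
      unfolding as_extend
      by (rule extend_compose_eqI[OF v], rule face_word_degeneracy_word_greater) (use that in auto)
    show "face op a (n + 1) i (degeneracy n i v) = face op a (n + 1) (i + 1) (degeneracy n i v)"
      if "1 \<le> i" "i \<le> n"
      unfolding as_extend
      by (rule extend_compose_eqI[OF v], rule face_word_degeneracy_word_eq) (use that in auto)
  qed
  ultimately show ?thesis ..
qed

end
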